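(* Let $n>1$ be an integer and let $\Gamma(\mathbb{Z}_{2^n}[i])$ be the zero-divisor graph of the ring $\mathbb{Z}_{2^n}[i]$. Then the size (number of edges) of $\Gamma(\mathbb{Z}_{2^n}[i])$ is $2^{2n-1}(n-1)-2^{n-1}+1$.
   Context: $\mathbb{Z}_{2^n}[i]=\{a+ib: a,b\in\mathbb{Z}_{2^n}\}\cong \mathbb{Z}[i]/\langle 2^n\rangle$ is the ring of Gaussian integers modulo $2^n$. For a commutative ring $R$, the zero-divisor graph $\Gamma(R)$ is the simple graph whose vertex set is the set $\mathcal{Z}(R)$ of nonzero zero-divisors of $R$, two distinct vertices $x,y$ being adjacent if and only if $xy=0$. *)

theory Defs
  imports "HOL-Number_Theory.Residues"
begin

text \<open>
  \<open>gauss_ring R\<close> is \<open>R[i]\<close>, where \<open>i\<^sup>2 = -1\<close>; the pair \<open>(a, b)\<close> stands for \<open>a + i b\<close>.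
\<close>

definition gauss_ring :: "('a, 'm) ring_scheme \<Rightarrow> ('a \<times> 'a) ring" where
  "gauss_ring R =
    \<lparr>carrier = carrier R \<times> carrier R,
     monoid.mult = \<lambda>(a, b) (c, d).
       ((a \<otimes>\<^bsub>R\<^esub> c) \<ominus>\<^bsub>R\<^esub> (b \<otimes>\<^bsub>R\<^esub> d), (a \<otimes>\<^bsub>R\<^esub> d) \<oplus>\<^bsub>R\<^esub> (b \<otimes>\<^bsub>R\<^esub> c)),
     one = (\<one>\<^bsub>R\<^esub>, \<zero>\<^bsub>R\<^esub>),
     zero = (\<zero>\<^bsub>R\<^esub>, \<zero>\<^bsub>R\<^esub>),
     add = \<lambda>(a, b) (c, d). (a \<oplus>\<^bsub>R\<^esub> c, b \<oplus>\<^bsub>R\<^esub> d)\<rparr>"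

lemma (in cring) cring_gauss_ring: "cring (gauss_ring R)"
proof (rule cringI)
  show "abelian_group (gauss_ring R)"
  proof (rule abelian_groupI)
    fix x assume "x \<in> carrier (gauss_ring R)"
    then show "\<exists>y\<in>carrier (gauss_ring R). y \<oplus>\<^bsub>gauss_ring R\<^esub> x = \<zero>\<^bsub>gauss_ring R\<^esub>"
      by (intro bexI[of _ "(\<ominus> fst x, \<ominus> snd x)"]) (auto simp: gauss_ring_def l_neg)
  qed (auto simp: gauss_ring_def a_ac)
  show "Group.comm_monoid (gauss_ring R)"
  proof (rule comm_monoidI)
    fix x y z
    assume "x \<in> carrier (gauss_ring R)" "y \<in> carrier (gauss_ring R)" "z \<in> carrier (gauss_ring R)"
    then show "x \<otimes>\<^bsub>gauss_ring R\<^esub> y \<otimes>\<^bsub>gauss_ring R\<^esub> z =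
        x \<otimes>\<^bsub>gauss_ring R\<^esub> (y \<otimes>\<^bsub>gauss_ring R\<^esub> z)"
      by (cases x; cases y; cases z) (simp add: gauss_ring_def, algebra)
  next
    fix x y
    assume "x \<in> carrier (gauss_ring R)" "y \<in> carrier (gauss_ring R)"
    then show "x \<otimes>\<^bsub>gauss_ring R\<^esub> y = y \<otimes>\<^bsub>gauss_ring R\<^esub> x"
      by (cases x; cases y) (simp add: gauss_ring_def, algebra)
  qed (auto simp: gauss_ring_def minus_eq)
next
  fix x y z
  assume "x \<in> carrier (gauss_ring R)" "y \<in> carrier (gauss_ring R)" "z \<in> carrier (gauss_ring R)"
  then show "(x \<oplus>\<^bsub>gauss_ring R\<^esub> y) \<otimes>\<^bsub>gauss_ring R\<^esub> z =
      x \<otimes>\<^bsub>gauss_ring R\<^esub> z \<oplus>\<^bsub>gauss_ring R\<^esub> y \<otimes>\<^bsub>gauss_ring R\<^esub> z"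
    by (cases x; cases y; cases z) (simp add: gauss_ring_def, algebra)
qed

definition zero_divisors :: "('a, 'm) ring_scheme \<Rightarrow> 'a set" where
  "zero_divisors R =
    {x \<in> carrier R. \<exists>y \<in> carrier R. y \<noteq> \<zero>\<^bsub>R\<^esub> \<and> x \<otimes>\<^bsub>R\<^esub> y = \<zero>\<^bsub>R\<^esub>}"

record 'a simple_graph =
  vertices :: "'a set"
  edges :: "'a set set"

definition zero_divisor_graph :: "('a, 'm) ring_scheme \<Rightarrow> 'a simple_graph" where
  "zero_divisor_graph R =
    (let V = zero_divisors R - {\<zero>\<^bsub>R\<^esub>} in
     \<lparr>vertices = V,
      edges = {{x, y} | x y. x \<in> V \<and> y \<in> V \<and> x \<noteq> y \<and> x \<otimes>\<^bsub>R\<^esub> y = \<zero>\<^bsub>R\<^esub>}\<rparr>)"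

definition graph_size :: "'a simple_graph \<Rightarrow> nat" where
  "graph_size G = card (edges G)"

end

theory Submission
  imports Defs
begin

text \<open>
  Let \<open>N (a + i b) = a\<^sup>2 + b\<^sup>2\<close>. Since a sum of two squares divisible by \<open>4\<close> has both terms even, a
  Gaussian integer \<open>z\<close> is divisible by \<open>2\<^sup>n\<close> iff \<open>2\<^bsup>2n\<^esup>\<close> divides \<open>N z\<close>. As \<open>N\<close> is multiplicative,
  \<open>x y = 0\<close> in the ring iff the \<open>2\<close>-adic valuations of \<open>N x\<close> and \<open>N y\<close> sum to at least \<open>2 n\<close>.
  Exactly \<open>2\<^bsup>2n - k\<^esup>\<close> elements have a norm divisible by \<open>2\<^sup>k\<close> (for \<open>k \<le> 2 n\<close>), so a nonzero element of
  valuation \<open>k\<close> annihilates \<open>2\<^sup>k - 1\<close> nonzero elements, and summing over \<open>k\<close> counts the ordered pairs.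
  The pairs \<open>(x, x)\<close> are removed (there are \<open>2\<^sup>n - 1\<close>) and the rest is halved.
\<close>

section \<open>Powers of two dividing the norm\<close>

definition norm2 :: "int \<times> int \<Rightarrow> int" where
  "norm2 = (\<lambda>(a, b). a\<^sup>2 + b\<^sup>2)"

lemma norm2_simp [simp]: "norm2 (a, b) = a\<^sup>2 + b\<^sup>2"
  by (simp add: norm2_def)

lemma norm2_eq_0_iff: "norm2 x = 0 \<longleftrightarrow> x = (0, 0)"
  by (cases x) (simp add: sum_power2_eq_zero_iff)

text \<open>Squares are 0 or 1 modulo 4, so two of them sum to 0 only if both are 0, that is, both
  bases are even.\<close>

lemma four_dvd_sum_squares_iff:
  fixes a b :: int
  shows "4 dvd a\<^sup>2 + b\<^sup>2 \<longleftrightarrow> even a \<and> even b"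
proof
  have even_sq: "\<exists>k. c\<^sup>2 = 4 * k" if "even c" for c :: int
    using that by (auto simp: power2_eq_square elim!: evenE)
  have odd_sq: "\<exists>k. c\<^sup>2 = 4 * k + 1" if "odd c" for c :: int
  proof -
    from that obtain m where "c = 2 * m + 1" by (rule oddE)
    then have "c\<^sup>2 = 4 * (m\<^sup>2 + m) + 1" by (simp add: power2_eq_square algebra_simps)
    then show ?thesis by blast
  qed
  show "even a \<and> even b" if "4 dvd a\<^sup>2 + b\<^sup>2"
  proof -
    consider "even a \<and> even b" | "even a \<and> odd b" | "odd a \<and> even b" | "odd a \<and> odd b" by blast
    then show ?thesis
    proof cases
      case 2
      with even_sq odd_sq obtain k l where "a\<^sup>2 = 4 * k" "b\<^sup>2 = 4 * l + 1" by blast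
      with that show ?thesis by presburger
    next
      case 3
      with even_sq odd_sq obtain k l where "a\<^sup>2 = 4 * k + 1" "b\<^sup>2 = 4 * l" by blast
      with that show ?thesis by presburger
    next
      case 4
      with odd_sq obtain k l where "a\<^sup>2 = 4 * k + 1" "b\<^sup>2 = 4 * l + 1" by blast
      with that show ?thesis by presburger
    qed
  qed
  show "4 dvd a\<^sup>2 + b\<^sup>2" if "even a \<and> even b"
    using that even_sq by (metis dvd_add dvd_triv_left)
qed

text \<open>Descent step: doubling both coordinates multiplies the norm by 4, and every norm
  divisible by 4 arises this way. It drives the inductions on \<open>n\<close> below, each lowering
  the exponent by two.\<close>

lemma dvd_norm2_Suc_Suc_iff:
  "2 ^ Suc (Suc k) dvd norm2 (a, b) \<longleftrightarrow>
    (\<exists>c d. a = 2 * c \<and> b = 2 * d \<and> 2 ^ k dvd norm2 (c, d))"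
proof
  assume dvd: "2 ^ Suc (Suc k) dvd norm2 (a, b)"
  have "(4 :: int) dvd 2 ^ Suc (Suc k)" by simp
  then have "4 dvd a\<^sup>2 + b\<^sup>2" using dvd dvd_trans by fastforce
  then obtain c d where cd: "a = 2 * c" "b = 2 * d"
    by (auto simp: four_dvd_sum_squares_iff elim!: evenE)
  have "4 * 2 ^ k dvd 4 * norm2 (c, d)"
    using dvd by (simp add: cd power_mult_distrib distrib_left)
  then have "2 ^ k dvd norm2 (c, d)"
    by (subst (asm) dvd_mult_cancel_left) simp
  with cd show "\<exists>c d. a = 2 * c \<and> b = 2 * d \<and> 2 ^ k dvd norm2 (c, d)" by blast
next
  assume "\<exists>c d. a = 2 * c \<and> b = 2 * d \<and> 2 ^ k dvd norm2 (c, d)"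
  then obtain c d where cd: "a = 2 * c" "b = 2 * d" "2 ^ k dvd norm2 (c, d)" by blast
  have "4 * 2 ^ k dvd 4 * norm2 (c, d)" using cd(3) by (rule mult_dvd_mono[OF dvd_refl])
  then show "2 ^ Suc (Suc k) dvd norm2 (a, b)"
    by (simp add: cd(1,2) power_mult_distrib distrib_left)
qed

lemma two_power_dvd_norm2_iff:
  "2 ^ (2 * n) dvd norm2 (a, b) \<longleftrightarrow> 2 ^ n dvd a \<and> 2 ^ n dvd b"
proof (induction n arbitrary: a b)
  case (Suc n)
  have "2 ^ (2 * Suc n) dvd norm2 (a, b) \<longleftrightarrow>
      (\<exists>c d. a = 2 * c \<and> b = 2 * d \<and> 2 ^ n dvd c \<and> 2 ^ n dvd d)"
    using dvd_norm2_Suc_Suc_iff[of "2 * n" a b] Suc.IH by (simp del: norm2_simp)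
  also have "\<dots> \<longleftrightarrow> 2 ^ Suc n dvd a \<and> 2 ^ Suc n dvd b"
    by (auto simp: dvd_def mult.assoc)
  finally show ?case .
qed simp

section \<open>Sizes of the norm levels\<close>

definition box :: "nat \<Rightarrow> (int \<times> int) set" where
  "box n = {0..<2 ^ n} \<times> {0..<2 ^ n}"

lemma finite_box [simp]: "finite (box n)"
  by (simp add: box_def)

lemma card_box: "card (box n) = 2 ^ (2 * n)"
  by (simp add: box_def card_cartesian_product nat_power_eq mult_2 power_add)

lemma zero_in_box [simp]: "(0, 0) \<in> box n"
  by (simp add: box_def)

definition norm_level :: "nat \<Rightarrow> nat \<Rightarrow> (int \<times> int) set" where
  "norm_level n k = {x \<in> box n. 2 ^ k dvd norm2 x}"

lemma finite_norm_level [simp]: "finite (norm_level n k)"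
  by (simp add: norm_level_def)

lemma card_norm_level_1: "2 * card (norm_level (Suc n) (Suc 0)) = 2 ^ (2 * Suc n)"
proof -
  let ?E = "norm_level (Suc n) (Suc 0)" and ?O = "box (Suc n) - norm_level (Suc n) (Suc 0)"
  \<comment> \<open>As \<open>2 ^ Suc n - 1\<close> is odd, this self-inverse reflection of the box
    flips the parity of \<open>b\<close>, hence of the norm.\<close>
  let ?f = "\<lambda>(a, b). (a, 2 ^ Suc n - 1 - b :: int)"
  have "bij_betw ?f ?E ?O"
    by (rule bij_betw_byWitness[where f' = ?f]) (auto simp: norm_level_def box_def)
  then have "card ?E = card ?O" by (rule bij_betw_same_card)
  moreover have "card ?O = card (box (Suc n)) - card ?E"
    by (rule card_Diff_subset) (auto simp: norm_level_def)
  moreover have "card ?E \<le> card (box (Suc n))"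
    by (rule card_mono) (auto simp: norm_level_def)
  ultimately show ?thesis by (simp add: card_box)
qed

text \<open>The even members of \<open>{0..<2 ^ Suc n}\<close> are the doubles of
  \<open>{0..<2 ^ n}\<close>, so the descent step is compatible with the boxes. Doubling being
  injective, it reduces the count to smaller \<open>n\<close>.\<close>

lemma norm_level_Suc_Suc:
  "norm_level (Suc n) (Suc (Suc k)) = (\<lambda>(a, b). (2 * a, 2 * b)) ` norm_level n k"
proof (rule Set.set_eqI)
  fix x :: "int \<times> int"
  obtain a b where x: "x = (a, b)" by (cases x)
  have "x \<in> norm_level (Suc n) (Suc (Suc k)) \<longleftrightarrow>
      (\<exists>c d. a = 2 * c \<and> b = 2 * d \<and> (c, d) \<in> norm_level n k)"
    unfolding norm_level_def x mem_Collect_eq dvd_norm2_Suc_Suc_iff by (auto simp: box_def)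
  then show "x \<in> norm_level (Suc n) (Suc (Suc k)) \<longleftrightarrow>
      x \<in> (\<lambda>(a, b). (2 * a, 2 * b)) ` norm_level n k"
    by (simp only: x image_iff Bex_def split_paired_Ex prod.case prod.inject) blast
qed

lemma card_norm_level:
  "k \<le> 2 * n \<Longrightarrow> card (norm_level n k) = 2 ^ (2 * n - k)"
proof (induction n arbitrary: k)
  case 0
  then show ?case using card_box[of 0] by (simp add: norm_level_def)
next
  case (Suc n)
  consider "k = 0" | "k = Suc 0" | j where "k = Suc (Suc j)" by (metis not0_implies_Suc)
  then show ?case
  proof cases
    case 1
    then show ?thesis by (simp add: norm_level_def card_box)
  next
    case 2
    then show ?thesis using card_norm_level_1[of n] by simp
  next
    case 3
    have "card (norm_level (Suc n) k) = card (norm_level n j)"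
      unfolding 3 norm_level_Suc_Suc by (rule card_image) (auto simp: inj_on_def)
    then show ?thesis using Suc 3 by simp
  qed
qed

lemma norm_level_top: "norm_level n (2 * n) = {(0, 0)}"
proof -
  have "card (norm_level n (2 * n)) = 1" by (simp add: card_norm_level)
  moreover have "(0, 0) \<in> norm_level n (2 * n)" by (simp add: norm_level_def)
  ultimately show ?thesis by (metis card_1_singletonE singletonD)
qed

section \<open>2-adic valuation of the norm\<close>

definition val2 :: "int \<times> int \<Rightarrow> nat" where
  "val2 x = multiplicity 2 (norm2 x)"

text \<open>The origin is excluded because \<open>multiplicity\<close> takes the default value 0 on
  a zero norm.\<close>

lemma dvd_norm2_iff_val2:
  "x \<noteq> (0, 0) \<Longrightarrow> 2 ^ k dvd norm2 x \<longleftrightarrow> k \<le> val2 x"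
  unfolding val2_def by (rule power_dvd_iff_le_multiplicity) (auto simp: norm2_eq_0_iff)

lemma dvd_norm2_mult_iff_val2:
  assumes "x \<noteq> (0, 0)" "y \<noteq> (0, 0)"
  shows "2 ^ k dvd norm2 x * norm2 y \<longleftrightarrow> k \<le> val2 x + val2 y"
proof -
  have nz: "norm2 x \<noteq> 0" "norm2 y \<noteq> 0" using assms by (simp_all add: norm2_eq_0_iff)
  then have "multiplicity 2 (norm2 x * norm2 y) = val2 x + val2 y"
    unfolding val2_def by (intro prime_elem_multiplicity_mult_distrib) auto
  moreover have "2 ^ k dvd norm2 x * norm2 y \<longleftrightarrow> k \<le> multiplicity 2 (norm2 x * norm2 y)"
    using nz by (intro power_dvd_iff_le_multiplicity) auto
  ultimately show ?thesis by simp
qed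

lemma val2_less:
  assumes "x \<in> box n" "x \<noteq> (0, 0)"
  shows "val2 x < 2 * n"
proof (rule ccontr)
  assume "\<not> val2 x < 2 * n"
  then have "x \<in> norm_level n (2 * n)"
    using assms by (simp add: norm_level_def dvd_norm2_iff_val2)
  with assms show False by (simp add: norm_level_top)
qed

section \<open>Counting ordered annihilating pairs\<close>

definition annihilating_pairs :: "nat \<Rightarrow> ((int \<times> int) \<times> (int \<times> int)) set" where
  "annihilating_pairs n = {(x, y). x \<in> box n - {(0, 0)} \<and> y \<in> box n - {(0, 0)} \<and>
    2 ^ (2 * n) dvd norm2 x * norm2 y}"

lemma finite_annihilating_pairs [simp]: "finite (annihilating_pairs n)"
  by (rule finite_subset[of _ "box n \<times> box n"]) (auto simp: annihilating_pairs_def)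

lemma card_val2_eq:
  assumes "k < 2 * n"
  shows "card {x \<in> box n - {(0, 0)}. val2 x = k} = 2 ^ (2 * n - Suc k)"
proof -
  have "{x \<in> box n - {(0, 0)}. val2 x = k} = norm_level n k - norm_level n (Suc k)"
  proof (rule Set.set_eqI)
    fix x
    show "x \<in> {x \<in> box n - {(0, 0)}. val2 x = k} \<longleftrightarrow> x \<in> norm_level n k - norm_level n (Suc k)"
    proof (cases "x = (0, 0)")
      case False
      then show ?thesis
        by (auto simp: norm_level_def dvd_norm2_iff_val2 simp del: power_Suc norm2_simp)
    qed (simp add: norm_level_def)
  qed
  moreover have "norm_level n (Suc k) \<subseteq> norm_level n k"
    unfolding norm_level_def by (auto intro: power_le_dvd[of 2 "Suc k"] simp del: power_Suc)
  ultimately have "card {x \<in> box n - {(0, 0)}. val2 x = k} = 2 ^ (2 * n - k) - 2 ^ (2 * n - Suc k)"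
    using assms by (simp add: card_Diff_subset card_norm_level)
  \<comment> \<open>With \<open>m = 2 * n - Suc k\<close>, the difference becomes
    \<open>2 ^ Suc m - 2 ^ m = 2 ^ m\<close>.\<close>
  moreover have "2 * n - k = Suc (2 * n - Suc k)" using assms by simp
  ultimately show ?thesis by simp
qed

text \<open>Since valuations add, the annihilators of \<open>x\<close>, origin included, form the
  level \<open>2 * n - val2 x\<close>, which has \<open>2 ^ val2 x\<close> elements.\<close>

lemma card_annihilators:
  assumes "x \<in> box n" "x \<noteq> (0, 0)"
  shows "card {y \<in> box n - {(0, 0)}. 2 ^ (2 * n) dvd norm2 x * norm2 y} = 2 ^ val2 x - 1"
proof -
  have "{y \<in> box n - {(0, 0)}. 2 ^ (2 * n) dvd norm2 x * norm2 y} =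
      norm_level n (2 * n - val2 x) - {(0, 0)}"
    using assms(2) by (auto simp: norm_level_def dvd_norm2_mult_iff_val2 dvd_norm2_iff_val2
        simp del: norm2_simp)
  moreover have "(0, 0) \<in> norm_level n (2 * n - val2 x)" by (simp add: norm_level_def)
  ultimately show ?thesis
    using val2_less[OF assms] by (simp add: card_norm_level)
qed

lemma card_annihilating_pairs:
  assumes "0 < n"
  shows "int (card (annihilating_pairs n)) = (2 * int n - 2) * 2 ^ (2 * n - 1) + 1"
proof -
  let ?B = "box n - {(0, 0)}"
  have "annihilating_pairs n = (SIGMA x:?B. {y \<in> ?B. 2 ^ (2 * n) dvd norm2 x * norm2 y})"
    by (auto simp: annihilating_pairs_def)
  then have "card (annihilating_pairs n) =
      (\<Sum>x\<in>?B. card {y \<in> ?B. 2 ^ (2 * n) dvd norm2 x * norm2 y})"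
    by (simp only:) (rule card_SigmaI, simp_all)
  also have "\<dots> = (\<Sum>x\<in>?B. 2 ^ val2 x - 1)"
    by (rule sum.cong) (use card_annihilators in auto)
  \<comment> \<open>Grouping by valuation; \<open>val2_less\<close> ensures that no element is
    missed.\<close>
  also have "\<dots> = (\<Sum>k<2 * n. \<Sum>x\<in>{x \<in> ?B. val2 x = k}. 2 ^ val2 x - 1)"
    by (rule sum.group[symmetric]) (auto intro: val2_less)
  also have "\<dots> = (\<Sum>k<2 * n. 2 ^ (2 * n - Suc k) * (2 ^ k - 1))"
  proof (rule sum.cong)
    fix k assume "k \<in> {..<2 * n}"
    then have "card {x \<in> ?B. val2 x = k} = 2 ^ (2 * n - Suc k)" by (intro card_val2_eq) simp
    moreover have "(\<Sum>x\<in>{x \<in> ?B. val2 x = k}. 2 ^ val2 x - 1 :: nat) =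
        (\<Sum>x\<in>{x \<in> ?B. val2 x = k}. 2 ^ k - 1)"
      by (rule sum.cong) auto
    ultimately show "(\<Sum>x\<in>{x \<in> ?B. val2 x = k}. 2 ^ val2 x - 1 :: nat) =
        2 ^ (2 * n - Suc k) * (2 ^ k - 1)"
      by (simp only: sum_constant of_nat_id)
  qed simp
  finally have "int (card (annihilating_pairs n)) =
      (\<Sum>k<2 * n. 2 ^ (2 * n - Suc k) * (2 ^ k - 1))"
    by (simp add: of_nat_diff)
  \<comment> \<open>The leading product is independent of \<open>k\<close>. Having passed to
    \<open>int\<close>, the multiplication distributes over a genuine subtraction.\<close>
  also have "\<dots> = (\<Sum>k<2 * n. 2 ^ (2 * n - 1) - 2 ^ (2 * n - Suc k))"
    by (rule sum.cong) (simp_all add: right_diff_distrib flip: power_add)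
  also have "\<dots> = 2 * int n * 2 ^ (2 * n - 1) - (\<Sum>k<2 * n. 2 ^ (2 * n - Suc k))"
    by (simp add: sum_subtractf)
  \<comment> \<open>Reversing the order of summation exposes a geometric sum.\<close>
  also have "(\<Sum>k<2 * n. 2 ^ (2 * n - Suc k)) = (\<Sum>k<2 * n. 2 ^ k :: int)"
    by (rule sum.nat_diff_reindex)
  also have "\<dots> = 2 ^ (2 * n) - 1"
    using power_diff_1_eq[of "2 :: int" "2 * n"] by simp
  \<comment> \<open>Expressed through \<open>2 ^ (2 * n - 1)\<close>, the geometric sum lowers the
    coefficient \<open>2 * n\<close> to \<open>2 * n - 2\<close>.\<close>
  also have "(2 :: int) ^ (2 * n) = 2 * 2 ^ (2 * n - 1)"
    using assms by (simp flip: power_Suc)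
  finally show ?thesis by (simp add: algebra_simps)
qed

text \<open>An element of valuation \<open>v\<close> squares to zero iff
  \<open>2 * v \<ge> 2 * n\<close>, so these are the nonzero members of level
  \<open>n\<close>.\<close>

lemma card_annihilating_diagonal:
  "card {x. (x, x) \<in> annihilating_pairs n} = 2 ^ n - 1"
proof -
  have "{x. (x, x) \<in> annihilating_pairs n} = norm_level n n - {(0, 0)}"
    by (auto simp: annihilating_pairs_def norm_level_def dvd_norm2_mult_iff_val2
        dvd_norm2_iff_val2 simp del: norm2_simp)
  moreover have "(0, 0) \<in> norm_level n n" by (simp add: norm_level_def)
  ultimately show ?thesis by (simp add: card_norm_level mult_2)
qed

section \<open>From ordered pairs to edges of the graph\<close>

lemma card_symmetric_pairs:
  assumes "finite S" "sym S" "irrefl S"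
  shows "card S = 2 * card {{x, y} | x y. (x, y) \<in> S}"
proof -
  let ?e = "\<lambda>(x, y). {x, y}"
  have img: "{{x, y} | x y. (x, y) \<in> S} = ?e ` S" by force
  \<comment> \<open>The fibre over an edge consists of its two orderings: symmetry supplies both,
    irreflexivity makes them distinct.\<close>
  have fib: "card {p \<in> S. ?e p = e} = 2" if "e \<in> ?e ` S" for e
  proof -
    from that obtain x y where xy: "(x, y) \<in> S" "e = {x, y}" by auto
    have yx: "(y, x) \<in> S" using assms(2) xy(1) by (rule symD)
    have "{p \<in> S. ?e p = e} = {(x, y), (y, x)}"
    proof (rule Set.set_eqI)
      fix p
      show "p \<in> {p \<in> S. ?e p = e} \<longleftrightarrow> p \<in> {(x, y), (y, x)}"
        using xy(1) yx by (cases p) (simp add: xy(2) doubleton_eq_iff, blast)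
    qed
    moreover have "x \<noteq> y" using xy(1) assms(3) by (auto simp: irrefl_def)
    ultimately show ?thesis by simp
  qed
  have "card S = (\<Sum>e\<in>?e ` S. card {p \<in> S. ?e p = e})"
    using sum.image_gen[OF assms(1), of "\<lambda>_. 1 :: nat" ?e] by simp
  also have "\<dots> = 2 * card (?e ` S)" using fib by simp
  finally show ?thesis unfolding img .
qed

text \<open>Residues are represented by integers, so ring elements are literally integer pairs and
  their norms can be taken unreduced.\<close>

lemma carrier_gauss_residue_ring:
  "carrier (gauss_ring (residue_ring (2 ^ n))) = box n"
  by (auto simp: gauss_ring_def residue_ring_def box_def)

lemma zero_gauss_residue_ring: "\<zero>\<^bsub>gauss_ring (residue_ring m)\<^esub> = (0, 0)"
  by (simp add: gauss_ring_def residue_ring_def)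

lemma gauss_residue_mult_eq_zero_iff:
  assumes "0 < n"
  shows "x \<otimes>\<^bsub>gauss_ring (residue_ring (2 ^ n))\<^esub> y = (0, 0) \<longleftrightarrow>
    2 ^ (2 * n) dvd norm2 x * norm2 y"
proof -
  obtain a b c d where xy: "x = (a, b)" "y = (c, d)" by (cases x, cases y)
  interpret residues "2 ^ n" "residue_ring (2 ^ n)"
    using assms by unfold_locales auto
  have "x \<otimes>\<^bsub>gauss_ring (residue_ring (2 ^ n))\<^esub> y =
      ((a * c - b * d) mod 2 ^ n, (a * d + b * c) mod 2 ^ n)"
    by (simp add: xy gauss_ring_def a_minus_def res_neg_eq res_add_eq res_mult_eq mod_simps)
  then have "x \<otimes>\<^bsub>gauss_ring (residue_ring (2 ^ n))\<^esub> y = (0, 0) \<longleftrightarrow>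
      2 ^ n dvd a * c - b * d \<and> 2 ^ n dvd a * d + b * c"
    by (simp add: dvd_eq_mod_eq_0)
  also have "\<dots> \<longleftrightarrow> 2 ^ (2 * n) dvd norm2 (a * c - b * d, a * d + b * c)"
    by (rule two_power_dvd_norm2_iff[symmetric])
  \<comment> \<open>Brahmagupta-Fibonacci identity, applied to the product before reduction modulo
    \<open>2 ^ n\<close>.\<close>
  also have "norm2 (a * c - b * d, a * d + b * c) = norm2 x * norm2 y"
    by (simp add: xy power2_eq_square algebra_simps)
  finally show ?thesis .
qed

text \<open>The vertex condition comes for free: two nonzero elements with product zero witness each
  other as zero divisors.\<close>

lemma edges_zero_divisor_graph_gauss:
  assumes "0 < n"
  shows "edges (zero_divisor_graph (gauss_ring (residue_ring (2 ^ n)))) =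
    {{x, y} | x y. (x, y) \<in> annihilating_pairs n - Id}"
proof -
  let ?G = "gauss_ring (residue_ring (2 ^ n))"
  let ?V = "zero_divisors ?G - {(0, 0)}"
  have "x \<in> ?V \<and> y \<in> ?V \<and> x \<noteq> y \<and> x \<otimes>\<^bsub>?G\<^esub> y = (0, 0) \<longleftrightarrow>
      (x, y) \<in> annihilating_pairs n - Id" for x y
    unfolding zero_divisors_def annihilating_pairs_def carrier_gauss_residue_ring
      zero_gauss_residue_ring gauss_residue_mult_eq_zero_iff[OF assms]
    by (auto simp: mult.commute simp del: norm2_simp)
  then show ?thesis
    unfolding zero_divisor_graph_def Let_def zero_gauss_residue_ring simple_graph.simps
    by (simp only:)
qed

theorem theorem2p1:
  fixes n :: nat
  assumes "n > 1"
  shows "int (graph_size (zero_divisor_graph (gauss_ring (residue_ring (2 ^ n))))) =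
    2 ^ (2 * n - 1) * (int n - 1) - 2 ^ (n - 1) + 1"
proof -
  let ?A = "annihilating_pairs n"
  have n: "0 < n" using assms by simp
  have "sym ?A" by (auto simp: annihilating_pairs_def sym_def mult.commute)
  then have "card (?A - Id) = 2 * graph_size (zero_divisor_graph (gauss_ring (residue_ring (2 ^ n))))"
    unfolding graph_size_def edges_zero_divisor_graph_gauss[OF n]
    by (intro card_symmetric_pairs) (auto simp: sym_def irrefl_def)
  moreover have "card ?A = card (?A - Id) + card (?A \<inter> Id)"
    by (metis card_Int_Diff add.commute finite_annihilating_pairs)
  moreover have "card (?A \<inter> Id) = card {x. (x, x) \<in> ?A}"
    by (rule bij_betw_same_card[of fst]) (force simp: bij_betw_def inj_on_def)
  moreover have "int (2 ^ n - 1) = 2 ^ n - 1" by (simp add: of_nat_diff)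
  ultimately have "2 * int (graph_size (zero_divisor_graph (gauss_ring (residue_ring (2 ^ n))))) =
      (2 * int n - 2) * 2 ^ (2 * n - 1) + 1 - (2 ^ n - 1)"
    using card_annihilating_pairs[OF n] card_annihilating_diagonal[of n] by linarith
  \<comment> \<open>With \<open>2 ^ n\<close> split, every term on the right is visibly even and the
    equation can be halved.\<close>
  moreover have "(2 :: int) ^ n = 2 * 2 ^ (n - 1)"
    using n by (simp flip: power_Suc)
  ultimately show ?thesis by (simp add: algebra_simps)
qed

end
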